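(* Let $\mathcal{B}$ be a bornology with a closed base on a metric space $(X,d)$ with at least two points. Then (i) $nw(C(X),\tau_{\mathcal{B}}^{sw}) = dn_{\mathcal{B}}^s(X)\cdot d(C(X),\tau_{\mathcal{B}}^{sw})\cdot nw(X,\mathcal{B})$; (ii) $nw(C(X),\tau_{\mathcal{B}}^{w}) = dn_{\mathcal{B}}(X)\cdot d(C(X),\tau_{\mathcal{B}}^{w})\cdot nw(X,\mathcal{B})$.
   Context: A bornology on $X$ is a family $\mathcal{B}$ of nonempty subsets of $X$ that covers $X$ and is an ideal, i.e. is closed under finite unions and under passing to nonempty subsets. A base for $\mathcal{B}$ is a subfamily $\mathcal{B}_0\subseteq\mathcal{B}$ such that every $B\in\mathcal{B}$ is contained in some $B'\in\mathcal{B}_0$; $\mathcal{B}$ has a closed base if it has a base all of whose members are closed in $(X,d)$. $C(X)$ is the set of continuous functions $X\to\mathbb{R}$, and $C^+(X)$ the set of continuous functions $X\to(0,\infty)$. For $A\subseteq X$ nonempty and $\delta>0$, $A^\delta=\bigcup_{x\in A}\{y\in X: d(x,y)<\delta\}$. The topology $\tau_{\mathcal{B}}^{sw}$ (strong Whitney convergence on $\mathcal{B}$) on $C(X)$ is induced by the uniformity having as a base the sets $[B,\epsilon]^{sw}=\{(f,g): \exists\,\delta>0\ \forall x\in B^\delta,\ |f(x)-g(x)|<\epsilon(x)\}$, and $\tau_{\mathcal{B}}^{w}$ (Whitney convergence on $\mathcal{B}$) by the uniformity having as a base the sets $[B,\epsilon]^{w}=\{(f,g): |f(x)-g(x)|<\epsilon(x)\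 \forall x\in B\}$, where $B\in\mathcal{B}$, $\epsilon\in C^+(X)$. A set $F\subseteq C(X)$ is dominating (resp. strongly dominating) with respect to $\mathcal{B}$ if for every $f\in C(X)$ and $B\in\mathcal{B}$ there is $g\in F$ with $f\le g$ on $B$ (resp. there are $g\in F$ and $\delta>0$ with $f\le g$ on $B^\delta$). Then $dn_{\mathcal{B}}(X)$ (resp. $dn_{\mathcal{B}}^s(X)$) is $\aleph_0$ plus the minimum cardinality of a dominating (resp. strongly dominating) subset of $C(X)$ with respect to $\mathcal{B}$. A $\mathcal{B}$-network on $X$ is a collection $\Lambda$ of nonempty subsets of $X$ such that for every $B\in\mathcal{B}$ and every open $U\subseteq X$ with $\overline{B}\subseteq U$ there is $C\in\Lambda$ with $\overline{B}\subseteq C\subseteq U$; $nw(X,\mathcal{B})=\aleph_0+\min\{|\Lambda|:\Lambda\text{ is a }\mathcal{B}\text{-network on }X\}$. For a topological space $Y$: the density is $d(Y)=\aleph_0+\min\{|D|: D\text{ dense in }Y\}$; a network on $Y$ is a collection $\mathscr{N}$ of nonempty subsets such that for each $y\in Y$ and open $U\ni y$ there is $C\in\mathscr{N}$ with $y\in C\subseteq U$; the network weight is $nw(Y)=\aleph_0+\min\{|\mathscr{N}|:\mathscr{N}\text{ is a network on }Y\}$. *)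

theory Defs
  imports "HOL-Analysis.Analysis"
begin

unbundle cardinal_syntax

section \<open>Cardinal functions\<close>

text \<open>
  Cardinals are represented by cardinal well-orders, compared up to \<open>=o\<close> and \<open>\<le>o\<close>, so that
  cardinals living over different types can be compared.
  \<open>min_card \<A>\<close> is the least cardinality of a member of a nonempty family \<open>\<A>\<close>.
\<close>

definition min_card :: "'a set set \<Rightarrow> 'a rel" where
  "min_card \<A> = |SOME A. A \<in> \<A> \<and> (\<forall>A'\<in>\<A>. |A| \<le>o |A'| )|"

lemma min_card:
  assumes "\<A> \<noteq> {}"
  shows "\<exists>A\<in>\<A>. min_card \<A> = |A|" and "\<And>A'. A' \<in> \<A> \<Longrightarrow> min_card \<A> \<le>o |A'|"
proof -
  have "\<exists>r\<in>card_of ` \<A>. \<forall>r'\<in>card_of ` \<A>. r \<le>o r'"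
    by (rule exists_minim_Card_order) (use assms in \<open>auto simp: card_of_Card_order\<close>)
  then have "\<exists>A. A \<in> \<A> \<and> (\<forall>A'\<in>\<A>. |A| \<le>o |A'| )"
    by auto
  note * = someI_ex[OF this]
  show "\<exists>A\<in>\<A>. min_card \<A> = |A|"
    unfolding min_card_def using * by blast
  show "min_card \<A> \<le>o |A'|" if "A' \<in> \<A>" for A'
    unfolding min_card_def using * that by blast
qed

definition dense_in_topology :: "'a topology \<Rightarrow> 'a set \<Rightarrow> bool" where
  "dense_in_topology Y D \<longleftrightarrow> D \<subseteq> topspace Y \<and> Y closure_of D = topspace Y"

definition topological_density :: "'a topology \<Rightarrow> (nat + 'a) rel" where
  "topological_density Y = natLeq +c min_card {D. dense_in_topology Y D}"

definition network_on :: "'a topology \<Rightarrow> 'a set set \<Rightarrow> bool" where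
  "network_on Y \<N> \<longleftrightarrow>
     (\<forall>C\<in>\<N>. C \<noteq> {} \<and> C \<subseteq> topspace Y) \<and>
     (\<forall>U y. openin Y U \<and> y \<in> U \<longrightarrow> (\<exists>C\<in>\<N>. y \<in> C \<and> C \<subseteq> U))"

definition network_weight :: "'a topology \<Rightarrow> (nat + 'a set) rel" where
  "network_weight Y = natLeq +c min_card {\<N>. network_on Y \<N>}"

section \<open>Bornologies\<close>

definition bornology :: "'a set set \<Rightarrow> bool" where
  "bornology \<B> \<longleftrightarrow>
     (\<forall>B\<in>\<B>. B \<noteq> {}) \<and> \<Union>\<B> = UNIV \<and>
     (\<forall>A\<in>\<B>. \<forall>B\<in>\<B>. A \<union> B \<in> \<B>) \<and>
     (\<forall>B\<in>\<B>. \<forall>A. A \<noteq> {} \<and> A \<subseteq> B \<longrightarrow> A \<in> \<B>)"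

definition bornology_base :: "'a set set \<Rightarrow> 'a set set \<Rightarrow> bool" where
  "bornology_base \<B> \<B>\<^sub>0 \<longleftrightarrow> \<B>\<^sub>0 \<subseteq> \<B> \<and> (\<forall>B\<in>\<B>. \<exists>B'\<in>\<B>\<^sub>0. B \<subseteq> B')"

definition has_closed_base :: "'a::topological_space set set \<Rightarrow> bool" where
  "has_closed_base \<B> \<longleftrightarrow> (\<exists>\<B>\<^sub>0. bornology_base \<B> \<B>\<^sub>0 \<and> (\<forall>B\<in>\<B>\<^sub>0. closed B))"

definition bornology_network :: "'a::topological_space set set \<Rightarrow> 'a set set \<Rightarrow> bool" where
  "bornology_network \<B> \<Lambda> \<longleftrightarrow>
     (\<forall>C\<in>\<Lambda>. C \<noteq> {}) \<and>
     (\<forall>B\<in>\<B>. \<forall>U. open U \<and> closure B \<subseteq> U \<longrightarrow> (\<exists>C\<in>\<Lambda>. closure B \<subseteq> C \<and> C \<subseteq> U))"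

definition bornology_network_weight :: "'a::topological_space set set \<Rightarrow> (nat + 'a set) rel" where
  "bornology_network_weight \<B> = natLeq +c min_card {\<Lambda>. bornology_network \<B> \<Lambda>}"

section \<open>Function spaces\<close>

definition cont_fun :: "('a::topological_space \<Rightarrow> real) set" where
  "cont_fun = {f. continuous_on UNIV f}"

definition pos_cont_fun :: "('a::topological_space \<Rightarrow> real) set" where
  "pos_cont_fun = {f. continuous_on UNIV f \<and> (\<forall>x. f x > 0)}"

definition enlargement :: "'a::metric_space set \<Rightarrow> real \<Rightarrow> 'a set" where
  "enlargement A \<delta> = (\<Union>x\<in>A. ball x \<delta>)"

text \<open>
  The topology on \<open>S\<close> induced by a uniformity on \<open>S\<close>, given as the filter of its entourages
  (cf. \<open>open_uniformity\<close> for the type class).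
\<close>

definition topology_of_uniformity :: "'a set \<Rightarrow> ('a \<times> 'a) filter \<Rightarrow> 'a topology" where
  "topology_of_uniformity S \<U> =
     topology (\<lambda>U. U \<subseteq> S \<and> (\<forall>x\<in>U. \<forall>\<^sub>F (x', y) in \<U>. x' = x \<longrightarrow> y \<in> U))"

lemma openin_topology_of_uniformity:
  "openin (topology_of_uniformity S \<U>) U \<longleftrightarrow>
     U \<subseteq> S \<and> (\<forall>x\<in>U. \<forall>\<^sub>F (x', y) in \<U>. x' = x \<longrightarrow> y \<in> U)"
proof -
  let ?P = "\<lambda>U. U \<subseteq> S \<and> (\<forall>x\<in>U. \<forall>\<^sub>F (x', y) in \<U>. x' = x \<longrightarrow> y \<in> U)"
  have "?P (A \<inter> B)" if "?P A" "?P B" for A B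
  proof (intro conjI ballI)
    fix x assume "x \<in> A \<inter> B"
    then have "\<forall>\<^sub>F (x', y) in \<U>. x' = x \<longrightarrow> y \<in> A" "\<forall>\<^sub>F (x', y) in \<U>. x' = x \<longrightarrow> y \<in> B"
      using that by blast+
    then show "\<forall>\<^sub>F (x', y) in \<U>. x' = x \<longrightarrow> y \<in> A \<inter> B"
      by eventually_elim auto
  qed (use that in auto)
  moreover have "?P (\<Union>\<K>)" if "\<forall>K\<in>\<K>. ?P K" for \<K>
  proof (intro conjI ballI)
    fix x assume "x \<in> \<Union>\<K>"
    then obtain K where "K \<in> \<K>" "x \<in> K" by auto
    then have "\<forall>\<^sub>F (x', y) in \<U>. x' = x \<longrightarrow> y \<in> K"
      using that by blast
    then show "\<forall>\<^sub>F (x', y) in \<U>. x' = x \<longrightarrow> y \<in> \<Union>\<K>"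
      by eventually_elim (use \<open>K \<in> \<K>\<close> in auto)
  qed (use that in auto)
  ultimately have "istopology ?P"
    unfolding istopology_def by blast
  then show ?thesis
    unfolding topology_of_uniformity_def by (simp add: topology_inverse')
qed

definition whitney_entourage ::
  "'a::metric_space set \<Rightarrow> ('a \<Rightarrow> real) \<Rightarrow> (('a \<Rightarrow> real) \<times> ('a \<Rightarrow> real)) set" where
  "whitney_entourage B \<epsilon> =
     {(f, g). f \<in> cont_fun \<and> g \<in> cont_fun \<and> (\<forall>x\<in>B. \<bar>f x - g x\<bar> < \<epsilon> x)}"

definition strong_whitney_entourage ::
  "'a::metric_space set \<Rightarrow> ('a \<Rightarrow> real) \<Rightarrow> (('a \<Rightarrow> real) \<times> ('a \<Rightarrow> real)) set" where
  "strong_whitney_entourage B \<epsilon> =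
     {(f, g). f \<in> cont_fun \<and> g \<in> cont_fun \<and>
        (\<exists>\<delta>>0. \<forall>x\<in>enlargement B \<delta>. \<bar>f x - g x\<bar> < \<epsilon> x)}"

text \<open>
  The filters below are generated by the entourages; when \<open>\<B>\<close> is a bornology, the entourages form
  a base, see \<open>eventually_whitney_uniformity\<close> and \<open>eventually_strong_whitney_uniformity\<close>.
\<close>

definition whitney_uniformity ::
  "'a::metric_space set set \<Rightarrow> (('a \<Rightarrow> real) \<times> ('a \<Rightarrow> real)) filter" where
  "whitney_uniformity \<B> = (INF (B, \<epsilon>)\<in>\<B> \<times> pos_cont_fun. principal (whitney_entourage B \<epsilon>))"

definition strong_whitney_uniformity ::
  "'a::metric_space set set \<Rightarrow> (('a \<Rightarrow> real) \<times> ('a \<Rightarrow> real)) filter" where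
  "strong_whitney_uniformity \<B> =
     (INF (B, \<epsilon>)\<in>\<B> \<times> pos_cont_fun. principal (strong_whitney_entourage B \<epsilon>))"

lemma bornology_times_pos_cont_fun_nonempty:
  assumes "bornology \<B>"
  shows "\<B> \<times> (pos_cont_fun :: ('a::metric_space \<Rightarrow> real) set) \<noteq> {}"
proof -
  have "(\<lambda>x::'a. 1) \<in> pos_cont_fun"
    by (simp add: pos_cont_fun_def)
  moreover have "\<B> \<noteq> {}"
    using assms by (auto simp: bornology_def)
  ultimately show ?thesis by blast
qed

lemma min_pos_cont_fun:
  "\<epsilon>\<^sub>1 \<in> pos_cont_fun \<Longrightarrow> \<epsilon>\<^sub>2 \<in> pos_cont_fun \<Longrightarrow> (\<lambda>x. min (\<epsilon>\<^sub>1 x) (\<epsilon>\<^sub>2 x)) \<in> pos_cont_fun"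
  by (auto simp: pos_cont_fun_def intro: continuous_on_min)

lemma whitney_entourage_mono:
  assumes "B \<subseteq> B'" and "\<And>x. \<epsilon>' x \<le> \<epsilon> x"
  shows "whitney_entourage B' \<epsilon>' \<subseteq> whitney_entourage B \<epsilon>"
  unfolding whitney_entourage_def using assms by (blast intro: less_le_trans)

lemma eventually_whitney_uniformity:
  fixes \<B> :: "'a::metric_space set set"
  assumes "bornology \<B>"
  shows "eventually P (whitney_uniformity \<B>) \<longleftrightarrow>
    (\<exists>B\<in>\<B>. \<exists>\<epsilon>\<in>pos_cont_fun. \<forall>z\<in>whitney_entourage B \<epsilon>. P z)"
proof -
  have "eventually P (whitney_uniformity \<B>) \<longleftrightarrow>
      (\<exists>b\<in>\<B> \<times> pos_cont_fun. eventually P (case b of (B, \<epsilon>) \<Rightarrow> principal (whitney_entourage B \<epsilon>)))"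
    unfolding whitney_uniformity_def
  proof (rule eventually_INF_base[OF bornology_times_pos_cont_fun_nonempty[OF assms]])
    fix a b :: "'a set \<times> ('a \<Rightarrow> real)"
    assume ab: "a \<in> \<B> \<times> pos_cont_fun" "b \<in> \<B> \<times> pos_cont_fun"
    let ?c = "(fst a \<union> fst b, \<lambda>x::'a. min (snd a x) (snd b x))"
    have "?c \<in> \<B> \<times> pos_cont_fun"
      using ab assms min_pos_cont_fun[of "snd a" "snd b"]
      by (simp add: bornology_def mem_Times_iff)
    then show "\<exists>x\<in>\<B> \<times> pos_cont_fun.
        (case x of (B, \<epsilon>) \<Rightarrow> principal (whitney_entourage B \<epsilon>)) \<le>
        inf (case a of (B, \<epsilon>) \<Rightarrow> principal (whitney_entourage B \<epsilon>))
            (case b of (B, \<epsilon>) \<Rightarrow> principal (whitney_entourage B \<epsilon>))"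
      by (rule bexI[rotated]) (simp add: case_prod_unfold whitney_entourage_mono)
  qed
  then show ?thesis
    by (simp add: eventually_principal Bex_def)
qed

lemma strong_whitney_entourage_mono:
  assumes "B \<subseteq> B'" and "\<And>x. \<epsilon>' x \<le> \<epsilon> x"
  shows "strong_whitney_entourage B' \<epsilon>' \<subseteq> strong_whitney_entourage B \<epsilon>"
proof -
  have "enlargement B \<delta> \<subseteq> enlargement B' \<delta>" for \<delta>
    using assms(1) by (auto simp: enlargement_def)
  then show ?thesis
    unfolding strong_whitney_entourage_def using assms(2) by (blast intro: less_le_trans)
qed

lemma eventually_strong_whitney_uniformity:
  fixes \<B> :: "'a::metric_space set set"
  assumes "bornology \<B>"
  shows "eventually P (strong_whitney_uniformity \<B>) \<longleftrightarrow>
    (\<exists>B\<in>\<B>. \<exists>\<epsilon>\<in>pos_cont_fun. \<forall>z\<in>strong_whitney_entourage B \<epsilon>. P z)"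
proof -
  have "eventually P (strong_whitney_uniformity \<B>) \<longleftrightarrow>
      (\<exists>b\<in>\<B> \<times> pos_cont_fun.
         eventually P (case b of (B, \<epsilon>) \<Rightarrow> principal (strong_whitney_entourage B \<epsilon>)))"
    unfolding strong_whitney_uniformity_def
  proof (rule eventually_INF_base[OF bornology_times_pos_cont_fun_nonempty[OF assms]])
    fix a b :: "'a set \<times> ('a \<Rightarrow> real)"
    assume ab: "a \<in> \<B> \<times> pos_cont_fun" "b \<in> \<B> \<times> pos_cont_fun"
    let ?c = "(fst a \<union> fst b, \<lambda>x::'a. min (snd a x) (snd b x))"
    have "?c \<in> \<B> \<times> pos_cont_fun"
      using ab assms min_pos_cont_fun[of "snd a" "snd b"]
      by (simp add: bornology_def mem_Times_iff)
    then show "\<exists>x\<in>\<B> \<times> pos_cont_fun.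
        (case x of (B, \<epsilon>) \<Rightarrow> principal (strong_whitney_entourage B \<epsilon>)) \<le>
        inf (case a of (B, \<epsilon>) \<Rightarrow> principal (strong_whitney_entourage B \<epsilon>))
            (case b of (B, \<epsilon>) \<Rightarrow> principal (strong_whitney_entourage B \<epsilon>))"
      by (rule bexI[rotated])
        (simp add: case_prod_unfold strong_whitney_entourage_mono)
  qed
  then show ?thesis
    by (simp add: eventually_principal Bex_def)
qed

definition whitney_topology :: "'a::metric_space set set \<Rightarrow> ('a \<Rightarrow> real) topology" where
  "whitney_topology \<B> = topology_of_uniformity cont_fun (whitney_uniformity \<B>)"

definition strong_whitney_topology :: "'a::metric_space set set \<Rightarrow> ('a \<Rightarrow> real) topology" where
  "strong_whitney_topology \<B> = topology_of_uniformity cont_fun (strong_whitney_uniformity \<B>)"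

lemma topspace_whitney_topology:
  assumes "bornology \<B>"
  shows "topspace (whitney_topology \<B>) = cont_fun"
proof (rule antisym)
  show "topspace (whitney_topology \<B>) \<subseteq> cont_fun"
    using openin_topspace[of "whitney_topology \<B>"]
    unfolding whitney_topology_def openin_topology_of_uniformity by auto
  have "openin (whitney_topology \<B>) cont_fun"
    unfolding whitney_topology_def openin_topology_of_uniformity
      eventually_whitney_uniformity[OF assms]
    using bornology_times_pos_cont_fun_nonempty[OF assms] by (auto simp: whitney_entourage_def)
  then show "cont_fun \<subseteq> topspace (whitney_topology \<B>)"
    by (rule openin_subset)
qed

lemma topspace_strong_whitney_topology:
  assumes "bornology \<B>"
  shows "topspace (strong_whitney_topology \<B>) = cont_fun"
proof (rule antisym)
  show "topspace (strong_whitney_topology \<B>) \<subseteq> cont_fun"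
    using openin_topspace[of "strong_whitney_topology \<B>"]
    unfolding strong_whitney_topology_def openin_topology_of_uniformity by auto
  have "openin (strong_whitney_topology \<B>) cont_fun"
    unfolding strong_whitney_topology_def openin_topology_of_uniformity
      eventually_strong_whitney_uniformity[OF assms]
    using bornology_times_pos_cont_fun_nonempty[OF assms]
    by (auto simp: strong_whitney_entourage_def)
  then show "cont_fun \<subseteq> topspace (strong_whitney_topology \<B>)"
    by (rule openin_subset)
qed

section \<open>Dominating numbers\<close>

definition dominating :: "'a::metric_space set set \<Rightarrow> ('a \<Rightarrow> real) set \<Rightarrow> bool" where
  "dominating \<B> F \<longleftrightarrow> F \<subseteq> cont_fun \<and>
     (\<forall>f\<in>cont_fun. \<forall>B\<in>\<B>. \<exists>g\<in>F. \<forall>x\<in>B. f x \<le> g x)"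

definition strongly_dominating :: "'a::metric_space set set \<Rightarrow> ('a \<Rightarrow> real) set \<Rightarrow> bool" where
  "strongly_dominating \<B> F \<longleftrightarrow> F \<subseteq> cont_fun \<and>
     (\<forall>f\<in>cont_fun. \<forall>B\<in>\<B>. \<exists>g\<in>F. \<exists>\<delta>>0. \<forall>x\<in>enlargement B \<delta>. f x \<le> g x)"

definition dominating_number :: "'a::metric_space set set \<Rightarrow> (nat + ('a \<Rightarrow> real)) rel" where
  "dominating_number \<B> = natLeq +c min_card {F. dominating \<B> F}"

definition strong_dominating_number :: "'a::metric_space set set \<Rightarrow> (nat + ('a \<Rightarrow> real)) rel" where
  "strong_dominating_number \<B> = natLeq +c min_card {F. strongly_dominating \<B> F}"

end

theory Submission
  imports Defs
begin

text \<open>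
  Both topologies have the same shape. Attach to a set \<open>B\<close> a filter \<open>\<Phi> B\<close>, the principal filter of
  \<open>B\<close> for Whitney convergence and the filter of the metric enlargements of \<open>B\<close> for strong Whitney
  convergence; then \<open>f\<close> and \<open>g\<close> are \<open>\<epsilon>\<close>-close iff \<open>\<bar>f - g\<bar> < \<epsilon>\<close> holds eventually along \<open>\<Phi> B\<close>, and
  domination is \<open>f \<le> g\<close> eventually along \<open>\<Phi> B\<close>. The equality of cardinals is proved once, in a
  locale that keeps only the properties of \<open>\<Phi>\<close> that matter, and is then instantiated twice.

  Lower bounds on the network weight. A dense set of functions is dominating: approximating
  \<open>f + 1\<close> up to \<open>1\<close> gives a function above \<open>f\<close>. Choosing one function from each member of a network
  gives a dense set. Finally, a member \<open>C\<close> of a network on the function space determines the set of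
  points at which all members of \<open>C\<close> are positive, and these sets form a \<open>\<B>\<close>-network: apply the
  network property to a Urysohn function that is \<open>1\<close> on \<open>closure B\<close> and \<open>0\<close> off \<open>U\<close>
  (\<open>bornology_network_of_network\<close>).

  Upper bound. From a dominating \<open>F\<close>, a dense \<open>D\<close> and a \<open>\<B>\<close>-network \<open>\<Lambda>\<close>, form for \<open>g \<in> F\<close>, \<open>d \<in> D\<close>,
  \<open>C \<in> \<Lambda>\<close> the set of the functions that are \<open>1 / (\<bar>g\<bar> + 1)\<close>-close to \<open>d\<close> along \<open>\<Phi> C\<close>. Domination makes the
  tolerances \<open>1 / (\<bar>g\<bar> + 1)\<close> cofinal among the positive continuous functions \<open>\<epsilon>\<close>, density
  provides the centres, and the \<open>\<B>\<close>-network replaces the sets \<open>B\<close>, so these sets form a network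
  (\<open>network_of_dominating_dense_network\<close>).
\<close>

section \<open>Minimal cardinalities with \<open>\<aleph>\<^sub>0\<close> added\<close>

lemma Cinfinite_natLeq_csum: "Cinfinite (natLeq +c r)"
  using natLeq_Cinfinite by (rule Cinfinite_csum1)

lemma natLeq_csum_min_card_le:
  assumes "A \<in> \<A>" and "|A| \<le>o r" and "Cinfinite r"
  shows "natLeq +c min_card \<A> \<le>o r"
proof (rule csum_cinfinite_bound)
  show "natLeq \<le>o r"
    using assms(3) by (rule natLeq_ordLeq_cinfinite)
  show "min_card \<A> \<le>o r"
    using min_card(2)[OF _ assms(1)] assms(1,2) by (blast intro: ordLeq_transitive)
  show "Card_order (min_card \<A>)"
    by (simp add: min_card_def card_of_Card_order)
qed (auto simp: assms(3) natLeq_Card_order)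

lemma natLeq_csum_min_card_witness:
  assumes "\<A> \<noteq> {}"
  obtains A where "A \<in> \<A>" and "|A| \<le>o natLeq +c min_card \<A>"
proof -
  obtain A where "A \<in> \<A>" and "min_card \<A> = |A|"
    using min_card(1)[OF assms] by blast
  moreover have "|A| \<le>o natLeq +c |A|"
    by (rule ordLeq_csum2) (rule card_of_Card_order)
  ultimately show thesis
    using that by metis
qed

lemma natLeq_csum_min_card_mono:
  assumes "\<A> \<noteq> {}" and "\<And>A. A \<in> \<A> \<Longrightarrow> \<exists>B\<in>\<B>. |B| \<le>o |A|"
  shows "natLeq +c min_card \<B> \<le>o natLeq +c min_card \<A>"
proof -
  obtain A where A: "A \<in> \<A>" "|A| \<le>o natLeq +c min_card \<A>"
    using natLeq_csum_min_card_witness[OF assms(1)] .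
  obtain B where B: "B \<in> \<B>" "|B| \<le>o |A|"
    using assms(2)[OF A(1)] by blast
  show ?thesis
    using B(1) ordLeq_transitive[OF B(2) A(2)] Cinfinite_natLeq_csum
    by (rule natLeq_csum_min_card_le)
qed

section \<open>Positive and separating continuous functions\<close>

lemma half_pos_cont_fun: "\<epsilon> \<in> pos_cont_fun \<Longrightarrow> (\<lambda>x. \<epsilon> x / 2) \<in> pos_cont_fun"
  by (auto simp: pos_cont_fun_def intro!: continuous_intros)

lemma inverse_pos_cont_fun:
  "g \<in> cont_fun \<Longrightarrow> (\<lambda>x. 1 / (\<bar>g x\<bar> + 1)) \<in> pos_cont_fun"
  by (auto simp: pos_cont_fun_def cont_fun_def add_nonneg_pos intro!: continuous_intros)

lemma separating_cont_fun:
  fixes S U :: "'a::metric_space set"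
  assumes "closed S" and "open U" and "S \<subseteq> U"
  obtains f where "f \<in> cont_fun" and "\<And>x. x \<in> S \<Longrightarrow> f x = (1::real)" and "\<And>x. x \<notin> U \<Longrightarrow> f x = 0"
proof -
  have "normal_space (euclidean :: 'a topology)"
    by (intro metrizable_imp_normal_space metrizable_space_euclidean)
  moreover have "closedin euclidean S" "closedin euclidean (- U)" "disjnt S (- U)"
    using assms by (auto simp: disjnt_def)
  ultimately obtain f :: "'a \<Rightarrow> real"
    where "continuous_map euclidean euclideanreal f" "f ` S \<subseteq> {1}" "f ` (- U) \<subseteq> {0}"
    by (rule Urysohn_lemma_alt)
  then show thesis
    using that[of f] by (auto simp: cont_fun_def)
qed

section \<open>Whitney-type topologies given by filters\<close>

text \<open>
  The condition \<open>nearby\<close> is what lets a \<open>\<B>\<close>-network stand in for \<open>\<B>\<close>: an open condition that holds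
  along \<open>\<Phi> B\<close> still holds along \<open>\<Phi> C\<close> for every set \<open>C\<close> close enough to the closed set \<open>B\<close>. For the
  principal filters the neighbourhood \<open>U\<close> may consist of all points where the condition holds; for
  the enlargement filters it must be smaller, since \<open>C\<close> has to keep a positive distance from the
  points where the condition fails.
\<close>

locale filtered_whitney =
  fixes \<B> :: "'a::metric_space set set"
    and \<Phi> :: "'a set \<Rightarrow> 'a filter"
    and \<U> :: "(('a \<Rightarrow> real) \<times> ('a \<Rightarrow> real)) filter"
  assumes bornology: "bornology \<B>"
    and closed_base: "has_closed_base \<B>"
    and principal_le: "principal B \<le> \<Phi> B"
    and filter_mono: "B \<subseteq> C \<Longrightarrow> \<Phi> B \<le> \<Phi> C"
    and nearby: "\<lbrakk>closed B; open {x. P x}; eventually P (\<Phi> B)\<rbrakk> \<Longrightarrow>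
      \<exists>U. open U \<and> B \<subseteq> U \<and> (\<forall>C\<subseteq>U. eventually P (\<Phi> C))"
    and eventually_uniformity: "eventually Q \<U> \<longleftrightarrow>
      (\<exists>B\<in>\<B>. \<exists>\<epsilon>\<in>pos_cont_fun. \<forall>f\<in>cont_fun. \<forall>g\<in>cont_fun.
         (\<forall>\<^sub>F x in \<Phi> B. \<bar>f x - g x\<bar> < \<epsilon> x) \<longrightarrow> Q (f, g))"
begin

abbreviation "fun_topology \<equiv> topology_of_uniformity cont_fun \<U>"

definition filter_dominating :: "('a \<Rightarrow> real) set \<Rightarrow> bool" where
  "filter_dominating F \<longleftrightarrow> F \<subseteq> cont_fun \<and>
     (\<forall>f\<in>cont_fun. \<forall>B\<in>\<B>. \<exists>g\<in>F. \<forall>\<^sub>F x in \<Phi> B. f x \<le> g x)"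

lemma eventually_imp_on: "eventually P (\<Phi> B) \<Longrightarrow> x \<in> B \<Longrightarrow> P x"
  using principal_le[of B] by (auto simp: le_filter_def eventually_principal)

lemma closure_in_bornology:
  assumes "B \<in> \<B>"
  shows "closure B \<in> \<B>"
proof -
  obtain B' where "B' \<in> \<B>" "B \<subseteq> B'" "closed B'"
    using closed_base assms unfolding has_closed_base_def bornology_base_def by blast
  moreover from this have "closure B \<subseteq> B'"
    by (simp add: closure_minimal)
  moreover have "closure B \<noteq> {}"
    using assms bornology by (auto simp: bornology_def)
  ultimately show ?thesis
    using bornology unfolding bornology_def by blast
qed

lemma openin_fun_topology:
  "openin fun_topology W \<longleftrightarrow> W \<subseteq> cont_fun \<and>
    (\<forall>f\<in>W. \<exists>B\<in>\<B>. \<exists>\<epsilon>\<in>pos_cont_fun. \<forall>g\<in>cont_fun.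
       (\<forall>\<^sub>F x in \<Phi> B. \<bar>f x - g x\<bar> < \<epsilon> x) \<longrightarrow> g \<in> W)"
proof -
  have at_point: "(\<forall>f'\<in>cont_fun. \<forall>g\<in>cont_fun. R f' g \<longrightarrow> f' = f \<longrightarrow> Q g) \<longleftrightarrow>
      (\<forall>g\<in>cont_fun. R f g \<longrightarrow> Q g)" if "f \<in> cont_fun"
    for f :: "'a \<Rightarrow> real" and R :: "('a \<Rightarrow> real) \<Rightarrow> ('a \<Rightarrow> real) \<Rightarrow> bool" and Q
    using that by blast
  show ?thesis
    unfolding openin_topology_of_uniformity eventually_uniformity prod.case
    by (rule conj_cong[OF refl], rule ball_cong[OF refl], (rule bex_cong[OF refl])+,
        rule at_point, blast)
qed

lemma topspace_fun_topology: "topspace fun_topology = cont_fun"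
proof (rule antisym)
  show "topspace fun_topology \<subseteq> cont_fun"
    using openin_topspace[of fun_topology] unfolding openin_fun_topology by blast
  have "openin fun_topology cont_fun"
    using bornology_times_pos_cont_fun_nonempty[OF bornology] unfolding openin_fun_topology
    by blast
  then show "cont_fun \<subseteq> topspace fun_topology"
    by (rule openin_subset)
qed

text \<open>
  The sections of the entourages need not be open, because \<open>\<epsilon> - \<bar>f - g\<bar>\<close> is positive near \<open>B\<close> only;
  by the triangle inequality the functions whose own tolerance ball stays in the section form an
  open set.
\<close>

lemma open_in_entourage_section:
  assumes "f \<in> cont_fun" "B \<in> \<B>" "\<epsilon> \<in> pos_cont_fun"
  obtains W where "openin fun_topology W" "f \<in> W"
    and "\<And>g. g \<in> W \<Longrightarrow> \<forall>\<^sub>F x in \<Phi> B. \<bar>f x - g x\<bar> < \<epsilon> x"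
proof
  let ?inner = "\<lambda>g B' \<epsilon>'. \<forall>h\<in>cont_fun. (\<forall>\<^sub>F x in \<Phi> B'. \<bar>g x - h x\<bar> < \<epsilon>' x) \<longrightarrow>
      (\<forall>\<^sub>F x in \<Phi> B. \<bar>f x - h x\<bar> < \<epsilon> x)"
  let ?W = "{g \<in> cont_fun. \<exists>B'\<in>\<B>. \<exists>\<epsilon>'\<in>pos_cont_fun. ?inner g B' \<epsilon>'}"
  show "f \<in> ?W"
    using assms by blast
  show "\<forall>\<^sub>F x in \<Phi> B. \<bar>f x - g x\<bar> < \<epsilon> x" if g: "g \<in> ?W" for g
  proof -
    obtain B' \<epsilon>' where \<epsilon>': "\<epsilon>' \<in> pos_cont_fun" "?inner g B' \<epsilon>'"
      using g by blast
    moreover have "\<forall>\<^sub>F x in \<Phi> B'. \<bar>g x - g x\<bar> < \<epsilon>' x"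
      using \<epsilon>'(1) by (simp add: pos_cont_fun_def)
    ultimately show ?thesis
      using g by blast
  qed
  show "openin fun_topology ?W"
    unfolding openin_fun_topology
  proof (intro conjI ballI)
    fix g assume "g \<in> ?W"
    then obtain B' \<epsilon>' where B': "B' \<in> \<B>" and \<epsilon>': "\<epsilon>' \<in> pos_cont_fun" and inner: "?inner g B' \<epsilon>'"
      by blast
    let ?half = "\<lambda>x. \<epsilon>' x / 2"
    have half: "?half \<in> pos_cont_fun"
      using \<epsilon>' by (rule half_pos_cont_fun)
    have "h \<in> ?W" if h: "h \<in> cont_fun" and gh: "\<forall>\<^sub>F x in \<Phi> B'. \<bar>g x - h x\<bar> < ?half x" for h
    proof -
      have "?inner h B' ?half"
      proof (intro ballI impI)
        fix k :: "'a \<Rightarrow> real"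
        assume "k \<in> cont_fun" and hk: "\<forall>\<^sub>F x in \<Phi> B'. \<bar>h x - k x\<bar> < ?half x"
        from gh hk have "\<forall>\<^sub>F x in \<Phi> B'. \<bar>g x - k x\<bar> < \<epsilon>' x"
          by eventually_elim linarith
        then show "\<forall>\<^sub>F x in \<Phi> B. \<bar>f x - k x\<bar> < \<epsilon> x"
          using inner \<open>k \<in> cont_fun\<close> by blast
      qed
      then show ?thesis
        using h by (intro CollectI conjI bexI[OF _ half] bexI[OF _ B'])
    qed
    then show "\<exists>B\<in>\<B>. \<exists>\<epsilon>\<in>pos_cont_fun. \<forall>h\<in>cont_fun.
        (\<forall>\<^sub>F x in \<Phi> B. \<bar>g x - h x\<bar> < \<epsilon> x) \<longrightarrow> h \<in> ?W"
      by (intro bexI[OF _ half] bexI[OF _ B'] ballI impI)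
  qed blast
qed

lemma dense_approximates:
  assumes "dense_in_topology fun_topology D" "f \<in> cont_fun" "B \<in> \<B>" "\<epsilon> \<in> pos_cont_fun"
  obtains d where "d \<in> D" "\<forall>\<^sub>F x in \<Phi> B. \<bar>f x - d x\<bar> < \<epsilon> x"
proof -
  obtain W where W: "openin fun_topology W" "f \<in> W"
      "\<And>g. g \<in> W \<Longrightarrow> \<forall>\<^sub>F x in \<Phi> B. \<bar>f x - g x\<bar> < \<epsilon> x"
    using open_in_entourage_section[OF assms(2-4)] by blast
  have "f \<in> fun_topology closure_of D"
    using assms(1,2) by (simp add: dense_in_topology_def topspace_fun_topology)
  then obtain d where "d \<in> D" "d \<in> W"
    using W(1,2) by (auto simp: in_closure_of)
  then show thesis
    using that W(3) by blast
qed

lemma dense_imp_filter_dominating: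
  assumes "dense_in_topology fun_topology D"
  shows "filter_dominating D"
  unfolding filter_dominating_def
proof (intro conjI ballI)
  show "D \<subseteq> cont_fun"
    using assms by (simp add: dense_in_topology_def topspace_fun_topology)
  fix f :: "'a \<Rightarrow> real" and B assume f: "f \<in> cont_fun" and B: "B \<in> \<B>"
  have "(\<lambda>x. f x + 1) \<in> cont_fun" "(\<lambda>x. 1) \<in> pos_cont_fun"
    using f by (auto simp: cont_fun_def pos_cont_fun_def intro!: continuous_intros)
  then obtain d where d: "d \<in> D" "\<forall>\<^sub>F x in \<Phi> B. \<bar>(f x + 1) - d x\<bar> < 1"
    using dense_approximates[OF assms _ B, of "\<lambda>x. f x + 1" "\<lambda>x. 1"] by blast
  from d(2) have "\<forall>\<^sub>F x in \<Phi> B. f x \<le> d x"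
    by eventually_elim linarith
  then show "\<exists>g\<in>D. \<forall>\<^sub>F x in \<Phi> B. f x \<le> g x"
    using d(1) by blast
qed

text \<open>
  If \<open>f \<in> C \<subseteq> W\<close>, where \<open>W\<close> contains only functions \<open>1\<close>-close to \<open>f\<close> on \<open>closure B\<close>, then the set of
  common positivity of \<open>C\<close> contains \<open>closure B\<close> because of \<open>C \<subseteq> W\<close>, and lies in \<open>U\<close> because of
  \<open>f \<in> C\<close>. Empty sets of positivity are discarded, as networks consist of nonempty sets.
\<close>

lemma bornology_network_of_network:
  assumes "network_on fun_topology \<N>"
  shows "bornology_network \<B> ((\<lambda>C. {x. \<forall>g\<in>C. g x > 0}) ` \<N> - {{}})"
  unfolding bornology_network_def
proof (intro conjI ballI allI impI)
  fix B U assume B: "B \<in> \<B>" and U: "open U \<and> closure B \<subseteq> U"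
  obtain f where f: "f \<in> cont_fun" "\<And>x. x \<in> closure B \<Longrightarrow> f x = 1" "\<And>x. x \<notin> U \<Longrightarrow> f x = 0"
    using separating_cont_fun[of "closure B" U] U by auto
  have "(\<lambda>x. 1) \<in> pos_cont_fun"
    by (simp add: pos_cont_fun_def)
  then obtain W where W: "openin fun_topology W" "f \<in> W"
      "\<And>g. g \<in> W \<Longrightarrow> \<forall>\<^sub>F x in \<Phi> (closure B). \<bar>f x - g x\<bar> < 1"
    using open_in_entourage_section[OF f(1) closure_in_bornology[OF B]] by blast
  obtain C where C: "C \<in> \<N>" "f \<in> C" "C \<subseteq> W"
    using assms W(1,2) unfolding network_on_def by blast
  let ?C = "{x. \<forall>g\<in>C. g x > 0}"
  have "closure B \<subseteq> ?C"
  proof safe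
    fix x g assume x: "x \<in> closure B" and "g \<in> C"
    then have "\<bar>f x - g x\<bar> < 1"
      using eventually_imp_on[OF W(3)] C(3) by blast
    then show "g x > 0"
      using f(2)[OF x] by linarith
  qed
  moreover have "?C \<subseteq> U"
    using C(2) f(3) by force
  moreover have "B \<noteq> {}"
    using B bornology by (auto simp: bornology_def)
  then have "?C \<noteq> {}"
    using \<open>closure B \<subseteq> ?C\<close> closure_subset[of B] by blast
  ultimately show "\<exists>C\<in>(\<lambda>C. {x. \<forall>g\<in>C. g x > 0}) ` \<N> - {{}}. closure B \<subseteq> C \<and> C \<subseteq> U"
    using C(1) by (intro bexI[of _ ?C]) simp_all
qed blast

text \<open>
  The function \<open>1 / (\<bar>g\<bar> + 1)\<close> is a positive continuous tolerance for every continuous \<open>g\<close>, and it is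
  below \<open>1 / g\<close> wherever \<open>g\<close> is positive, so large \<open>g\<close> give small tolerances. Closeness is required
  along \<open>\<Phi> C\<close> rather than on \<open>C\<close>: for the enlargement filter, closeness on \<open>C\<close> alone
  says nothing uniform around a set \<open>B \<subseteq> C\<close>.
\<close>

definition tolerance_ball :: "('a \<Rightarrow> real) \<times> ('a \<Rightarrow> real) \<times> 'a set \<Rightarrow> ('a \<Rightarrow> real) set" where
  "tolerance_ball = (\<lambda>(g, d, C). {f \<in> cont_fun. \<forall>\<^sub>F x in \<Phi> C. \<bar>f x - d x\<bar> < 1 / (\<bar>g x\<bar> + 1)})"

lemma network_of_dominating_dense_network:
  assumes F: "filter_dominating F"
    and D: "dense_in_topology fun_topology D"
    and \<Lambda>: "bornology_network \<B> \<Lambda>"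
  shows "network_on fun_topology (tolerance_ball ` (F \<times> D \<times> \<Lambda>) - {{}})"
  unfolding network_on_def
proof (intro conjI ballI allI impI)
  fix C assume "C \<in> tolerance_ball ` (F \<times> D \<times> \<Lambda>) - {{}}"
  then show "C \<noteq> {}" "C \<subseteq> topspace fun_topology"
    by (auto simp: tolerance_ball_def topspace_fun_topology)
next
  fix W f assume W: "openin fun_topology W \<and> f \<in> W"
  then obtain B\<^sub>0 \<epsilon> where B\<^sub>0: "B\<^sub>0 \<in> \<B>" and \<epsilon>: "\<epsilon> \<in> pos_cont_fun"
    and sub: "\<And>h. h \<in> cont_fun \<Longrightarrow> \<forall>\<^sub>F x in \<Phi> B\<^sub>0. \<bar>f x - h x\<bar> < \<epsilon> x \<Longrightarrow> h \<in> W"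
    unfolding openin_fun_topology by blast
  have f: "f \<in> cont_fun"
    using W unfolding openin_fun_topology by blast
  define B where "B = closure B\<^sub>0"
  have B: "B \<in> \<B>" "closed B"
    using closure_in_bornology[OF B\<^sub>0] by (simp_all add: B_def)
  have \<epsilon>_pos: "\<epsilon> x > 0" for x
    using \<epsilon> by (simp add: pos_cont_fun_def)
  \<comment> \<open>Two functions in the same tolerance ball differ by less than twice the tolerance, so the
    tolerance has to be below \<open>\<epsilon> / 2\<close>.\<close>
  have "(\<lambda>x. 2 / \<epsilon> x) \<in> cont_fun"
    using \<epsilon> by (auto simp: cont_fun_def pos_cont_fun_def less_imp_neq[symmetric]
        intro!: continuous_intros)
  then obtain g where g: "g \<in> F" "\<forall>\<^sub>F x in \<Phi> B. 2 / \<epsilon> x \<le> g x"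
    using bspec[OF bspec[OF conjunct2[OF F[unfolded filter_dominating_def]]] B(1)] by blast
  have g_cont: "g \<in> cont_fun"
    using F g(1) unfolding filter_dominating_def by blast
  let ?t = "\<lambda>x. 1 / (\<bar>g x\<bar> + 1)"
  have t: "?t \<in> pos_cont_fun"
    using g_cont by (rule inverse_pos_cont_fun)
  have t_small: "\<forall>\<^sub>F x in \<Phi> B. ?t x < \<epsilon> x / 2"
    using g(2)
  proof eventually_elim
    case (elim x)
    then have "2 / \<epsilon> x < \<bar>g x\<bar> + 1"
      by linarith
    then have "2 < (\<bar>g x\<bar> + 1) * \<epsilon> x"
      using \<epsilon>_pos[of x] by (simp add: pos_divide_less_eq)
    then show ?case
      by (simp add: field_simps)
  qed
  obtain d where d: "d \<in> D" "\<forall>\<^sub>F x in \<Phi> B. \<bar>f x - d x\<bar> < ?t x"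
    using dense_approximates[OF D f B(1) t] .
  have d_cont: "d \<in> cont_fun"
    using D d(1) by (auto simp: dense_in_topology_def topspace_fun_topology)
  \<comment> \<open>Strict inequalities between continuous functions: an open condition, which passes from \<open>B\<close> to a
    member \<open>C\<close> of the network.\<close>
  let ?P = "\<lambda>x. \<bar>f x - d x\<bar> < ?t x \<and> ?t x < \<epsilon> x / 2"
  have "open {x. ?P x}"
    using f d_cont g_cont \<epsilon> unfolding cont_fun_def pos_cont_fun_def
    by (intro open_Collect_conj open_Collect_less continuous_intros) (auto simp: add_nonneg_eq_0_iff)
  then obtain U where U: "open U" "B \<subseteq> U" "\<And>C. C \<subseteq> U \<Longrightarrow> eventually ?P (\<Phi> C)"
    using nearby[OF B(2), of ?P] eventually_conj[OF d(2) t_small] by blast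
  obtain C where C: "C \<in> \<Lambda>" "B \<subseteq> C" "C \<subseteq> U"
    using \<Lambda> B\<^sub>0 U(1,2) unfolding bornology_network_def B_def by blast
  have P_C: "eventually ?P (\<Phi> C)"
    using U(3) C(3) .
  let ?N = "tolerance_ball (g, d, C)"
  have "f \<in> ?N"
    using f P_C by (auto simp: tolerance_ball_def elim: eventually_mono)
  moreover have "?N \<subseteq> W"
  proof
    fix h assume "h \<in> ?N"
    then have h: "h \<in> cont_fun" "\<forall>\<^sub>F x in \<Phi> C. \<bar>h x - d x\<bar> < ?t x"
      by (simp_all add: tolerance_ball_def)
    from h(2) P_C have "\<forall>\<^sub>F x in \<Phi> C. \<bar>f x - h x\<bar> < \<epsilon> x"
      by eventually_elim linarith
    moreover have "\<Phi> B\<^sub>0 \<le> \<Phi> C"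
      using C(2) closure_subset[of B\<^sub>0] by (intro filter_mono) (auto simp: B_def)
    ultimately show "h \<in> W"
      using sub[OF h(1)] by (auto simp: le_filter_def)
  qed
  ultimately show "\<exists>C\<in>tolerance_ball ` (F \<times> D \<times> \<Lambda>) - {{}}. f \<in> C \<and> C \<subseteq> W"
    using g(1) d(1) C(1) by (intro bexI[of _ ?N]) auto
qed

text \<open>
  A \<open>min_card\<close> is attained only over a nonempty family; the next four lemmas provide this for the four
  cardinal functions.
\<close>

lemma ex_network: "{\<N>. network_on fun_topology \<N>} \<noteq> {}"
proof -
  have "network_on fun_topology {W. openin fun_topology W \<and> W \<noteq> {}}"
    by (auto simp: network_on_def dest: openin_subset)
  then show ?thesis by blast
qed

lemma ex_dense: "{D. dense_in_topology fun_topology D} \<noteq> {}"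
proof -
  have "dense_in_topology fun_topology (topspace fun_topology)"
    by (simp add: dense_in_topology_def)
  then show ?thesis by blast
qed

lemma ex_filter_dominating: "{F. filter_dominating F} \<noteq> {}"
  using ex_dense dense_imp_filter_dominating by blast

lemma ex_bornology_network: "{\<Lambda>. bornology_network \<B> \<Lambda>} \<noteq> {}"
  using ex_network bornology_network_of_network by blast

lemma filter_dominating_number_le_density:
  "natLeq +c min_card {F. filter_dominating F} \<le>o topological_density fun_topology"
  unfolding topological_density_def
proof (rule natLeq_csum_min_card_mono[OF ex_dense])
  fix D assume "D \<in> {D. dense_in_topology fun_topology D}"
  then show "\<exists>F\<in>{F. filter_dominating F}. |F| \<le>o |D|"
    by (intro bexI[of _ D]) (simp_all add: dense_imp_filter_dominating card_of_refl ordIso_imp_ordLeq)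
qed

lemma density_le_network_weight:
  "topological_density fun_topology \<le>o network_weight fun_topology"
  unfolding topological_density_def network_weight_def
proof (rule natLeq_csum_min_card_mono[OF ex_network])
  fix \<N> assume "\<N> \<in> {\<N>. network_on fun_topology \<N>}"
  then have \<N>: "network_on fun_topology \<N>" by simp
  let ?D = "(\<lambda>C. SOME f. f \<in> C) ` \<N>"
  have some: "(SOME f. f \<in> C) \<in> C" if "C \<in> \<N>" for C
    using \<N> that by (auto simp: network_on_def some_in_eq)
  have "dense_in_topology fun_topology ?D"
    unfolding dense_in_topology_def
  proof (intro conjI antisym subsetI)
    show "f \<in> topspace fun_topology" if "f \<in> ?D" for f
      using that some \<N> by (auto simp: network_on_def)
    show "f \<in> fun_topology closure_of ?D" if f: "f \<in> topspace fun_topology" for f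
      unfolding in_closure_of
    proof (intro conjI f allI impI)
      fix W assume "f \<in> W \<and> openin fun_topology W"
      then obtain C where "C \<in> \<N>" "C \<subseteq> W"
        using \<N> unfolding network_on_def by blast
      then show "\<exists>y. y \<in> ?D \<and> y \<in> W"
        using some by blast
    qed
  qed (simp add: in_closure_of)
  then show "\<exists>D\<in>{D. dense_in_topology fun_topology D}. |D| \<le>o |\<N>|"
    using card_of_image by blast
qed

lemma bornology_network_weight_le_network_weight:
  "bornology_network_weight \<B> \<le>o network_weight fun_topology"
  unfolding bornology_network_weight_def network_weight_def
proof (rule natLeq_csum_min_card_mono[OF ex_network])
  fix \<N> assume "\<N> \<in> {\<N>. network_on fun_topology \<N>}"
  moreover have "|(\<lambda>C. {x. \<forall>g\<in>C. g x > 0}) ` \<N> - {{}}| \<le>o |\<N>|"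
    using card_of_mono1[OF Diff_subset] card_of_image by (rule ordLeq_transitive)
  ultimately show "\<exists>\<Lambda>\<in>{\<Lambda>. bornology_network \<B> \<Lambda>}. |\<Lambda>| \<le>o |\<N>|"
    using bornology_network_of_network by blast
qed

theorem network_weight_fun_topology:
  "network_weight fun_topology =o
     (natLeq +c min_card {F. filter_dominating F}) *c topological_density fun_topology *c
       bornology_network_weight \<B>"
proof (rule ordIso_iff_ordLeq[THEN iffD2, OF conjI])
  let ?nw = "network_weight fun_topology"
  let ?dn = "natLeq +c min_card {F. filter_dominating F}"
  let ?dens = "topological_density fun_topology"
  let ?bnw = "bornology_network_weight \<B>"
  have inf: "Cinfinite ?nw" "Cinfinite ?dn" "Cinfinite ?dens" "Cinfinite ?bnw"
    by (simp_all only: network_weight_def topological_density_def bornology_network_weight_def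
        Cinfinite_natLeq_csum)
  show "?dn *c ?dens *c ?bnw \<le>o ?nw"
  proof (intro cprod_cinfinite_bound)
    show "?dn \<le>o ?nw"
      using filter_dominating_number_le_density density_le_network_weight
      by (rule ordLeq_transitive)
  qed (use inf density_le_network_weight bornology_network_weight_le_network_weight
      in \<open>auto simp: Card_order_cprod\<close>)
  obtain F where F: "filter_dominating F" "|F| \<le>o ?dn"
    using natLeq_csum_min_card_witness[OF ex_filter_dominating] by blast
  obtain D where D: "dense_in_topology fun_topology D" "|D| \<le>o ?dens"
    using natLeq_csum_min_card_witness[OF ex_dense] unfolding topological_density_def by blast
  obtain \<Lambda> where \<Lambda>: "bornology_network \<B> \<Lambda>" "|\<Lambda>| \<le>o ?bnw"
    using natLeq_csum_min_card_witness[OF ex_bornology_network]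
    unfolding bornology_network_weight_def by blast
  let ?\<N> = "tolerance_ball ` (F \<times> D \<times> \<Lambda>) - {{}}"
  have "|?\<N>| \<le>o |F \<times> D \<times> \<Lambda>|"
    using card_of_mono1[OF Diff_subset] card_of_image by (rule ordLeq_transitive)
  also have "|F \<times> D \<times> \<Lambda>| = |F| *c |D| *c |\<Lambda>|"
    by (simp add: cprod_def Field_card_of)
  also have "|F| *c |D| *c |\<Lambda>| \<le>o ?dn *c ?dens *c ?bnw"
    by (intro cprod_mono F(2) D(2) \<Lambda>(2))
  finally have "|?\<N>| \<le>o ?dn *c ?dens *c ?bnw" .
  moreover have "?\<N> \<in> {\<N>. network_on fun_topology \<N>}"
    using network_of_dominating_dense_network[OF F(1) D(1) \<Lambda>(1)] by simp
  moreover have "Cinfinite (?dn *c ?dens *c ?bnw)"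
    using inf by (intro conjI cinfinite_cprod Card_order_cprod) auto
  ultimately show "?nw \<le>o ?dn *c ?dens *c ?bnw"
    unfolding network_weight_def by (intro natLeq_csum_min_card_le)
qed

end

section \<open>The two instances\<close>

lemma filtered_whitney_principal:
  assumes "bornology \<B>" "has_closed_base \<B>"
  shows "filtered_whitney \<B> principal (whitney_uniformity \<B>)"
proof
  fix B :: "'a set" and P assume "closed B" "open {x. P x}" "eventually P (principal B)"
  then show "\<exists>U. open U \<and> B \<subseteq> U \<and> (\<forall>C\<subseteq>U. eventually P (principal C))"
    by (intro exI[of _ "{x. P x}"]) (auto simp: eventually_principal)
next
  fix Q :: "('a \<Rightarrow> real) \<times> ('a \<Rightarrow> real) \<Rightarrow> bool"
  show "eventually Q (whitney_uniformity \<B>) \<longleftrightarrow>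
      (\<exists>B\<in>\<B>. \<exists>\<epsilon>\<in>pos_cont_fun. \<forall>f\<in>cont_fun. \<forall>g\<in>cont_fun.
         (\<forall>\<^sub>F x in principal B. \<bar>f x - g x\<bar> < \<epsilon> x) \<longrightarrow> Q (f, g))"
    unfolding eventually_whitney_uniformity[OF assms(1)] whitney_entourage_def
      eventually_principal by (simp add: Ball_def imp_conjL)
qed (use assms in auto)

definition enlargement_filter :: "'a::metric_space set \<Rightarrow> 'a filter" where
  "enlargement_filter B = (INF \<delta>\<in>{0<..}. principal (enlargement B \<delta>))"

lemma enlargement_mono: "B \<subseteq> C \<Longrightarrow> \<delta> \<le> \<delta>' \<Longrightarrow> enlargement B \<delta> \<subseteq> enlargement C \<delta>'"
  using subset_ball[of \<delta> \<delta>'] by (auto simp: enlargement_def)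

lemma eventually_enlargement_filter:
  "eventually P (enlargement_filter B) \<longleftrightarrow> (\<exists>\<delta>>0. \<forall>x\<in>enlargement B \<delta>. P x)"
proof -
  have "eventually P (enlargement_filter B) \<longleftrightarrow>
      (\<exists>\<delta>\<in>{0<..}. eventually P (principal (enlargement B \<delta>)))"
    unfolding enlargement_filter_def
  proof (rule eventually_INF_base)
    fix \<delta> \<delta>' :: real assume "\<delta> \<in> {0<..}" "\<delta>' \<in> {0<..}"
    then show "\<exists>\<eta>\<in>{0<..}. principal (enlargement B \<eta>) \<le>
        inf (principal (enlargement B \<delta>)) (principal (enlargement B \<delta>'))"
      by (intro bexI[of _ "min \<delta> \<delta>'"]) (simp_all add: enlargement_mono)
  qed auto
  then show ?thesis
    by (auto simp: eventually_principal)
qed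

lemma subset_enlargement: "\<delta> > 0 \<Longrightarrow> B \<subseteq> enlargement B \<delta>"
  by (auto simp: enlargement_def)

lemma open_enlargement: "open (enlargement B \<delta>)"
  by (simp add: enlargement_def open_UN)

lemma enlargement_enlargement: "enlargement (enlargement B \<delta>) \<delta>' \<subseteq> enlargement B (\<delta> + \<delta>')"
proof
  fix z assume "z \<in> enlargement (enlargement B \<delta>) \<delta>'"
  then obtain x y where "x \<in> B" "dist x y < \<delta>" "dist y z < \<delta>'"
    by (auto simp: enlargement_def)
  then show "z \<in> enlargement B (\<delta> + \<delta>')"
    using dist_triangle[of x z y] by (auto simp: enlargement_def intro!: bexI[of _ x])
qed

lemma filtered_whitney_enlargement:
  assumes "bornology \<B>" "has_closed_base \<B>"
  shows "filtered_whitney \<B> enlargement_filter (strong_whitney_uniformity \<B>)"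
proof
  show "principal B \<le> enlargement_filter B" for B :: "'a set"
    using subset_enlargement
    by (fastforce simp: le_filter_def eventually_principal eventually_enlargement_filter)
  show "enlargement_filter B \<le> enlargement_filter C" if "B \<subseteq> C" for B C :: "'a set"
    using enlargement_mono[OF that order_refl]
    by (fastforce simp: le_filter_def eventually_enlargement_filter)
next
  fix B :: "'a set" and P assume "eventually P (enlargement_filter B)"
  then obtain \<delta> where \<delta>: "\<delta> > 0" "\<forall>x\<in>enlargement B \<delta>. P x"
    by (auto simp: eventually_enlargement_filter)
  \<comment> \<open>Half of the enlargement is the room for \<open>C\<close>, the other half the room for an enlargement of
    \<open>C\<close>.\<close>
  have "eventually P (enlargement_filter C)" if "C \<subseteq> enlargement B (\<delta> / 2)" for C
  proof -
    have "enlargement C (\<delta> / 2) \<subseteq> enlargement B (\<delta> / 2 + \<delta> / 2)"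
      using enlargement_mono[OF that order_refl] enlargement_enlargement by (rule subset_trans)
    then show ?thesis
      unfolding eventually_enlargement_filter using \<delta> by (intro exI[of _ "\<delta> / 2"]) auto
  qed
  then show "\<exists>U. open U \<and> B \<subseteq> U \<and> (\<forall>C\<subseteq>U. eventually P (enlargement_filter C))"
    using open_enlargement subset_enlargement[of "\<delta> / 2" B] \<delta>(1)
    by (intro exI[of _ "enlargement B (\<delta> / 2)"]) auto
next
  fix Q :: "('a \<Rightarrow> real) \<times> ('a \<Rightarrow> real) \<Rightarrow> bool"
  show "eventually Q (strong_whitney_uniformity \<B>) \<longleftrightarrow>
      (\<exists>B\<in>\<B>. \<exists>\<epsilon>\<in>pos_cont_fun. \<forall>f\<in>cont_fun. \<forall>g\<in>cont_fun.
         (\<forall>\<^sub>F x in enlargement_filter B. \<bar>f x - g x\<bar> < \<epsilon> x) \<longrightarrow> Q (f, g))"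
    unfolding eventually_strong_whitney_uniformity[OF assms(1)] strong_whitney_entourage_def
      eventually_enlargement_filter by (simp add: Ball_def imp_conjL)
qed (use assms in auto)

theorem theorem4p10:
  fixes \<B> :: "'a::metric_space set set"
  assumes "\<exists>x y :: 'a. x \<noteq> y"
    and "bornology \<B>"
    and "has_closed_base \<B>"
  shows
    "network_weight (strong_whitney_topology \<B>) =o
       strong_dominating_number \<B> *c topological_density (strong_whitney_topology \<B>) *c
         bornology_network_weight \<B>
     \<and>
     network_weight (whitney_topology \<B>) =o
       dominating_number \<B> *c topological_density (whitney_topology \<B>) *c bornology_network_weight \<B>"
proof
  interpret strong: filtered_whitney \<B> enlargement_filter "strong_whitney_uniformity \<B>"
    using assms(2,3) by (rule filtered_whitney_enlargement)
  have "strong.filter_dominating = strongly_dominating \<B>"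
    by (simp add: fun_eq_iff strong.filter_dominating_def strongly_dominating_def
        eventually_enlargement_filter)
  then show "network_weight (strong_whitney_topology \<B>) =o
      strong_dominating_number \<B> *c topological_density (strong_whitney_topology \<B>) *c
        bornology_network_weight \<B>"
    using strong.network_weight_fun_topology
    by (simp add: strong_whitney_topology_def strong_dominating_number_def)
next
  interpret weak: filtered_whitney \<B> principal "whitney_uniformity \<B>"
    using assms(2,3) by (rule filtered_whitney_principal)
  have "weak.filter_dominating = dominating \<B>"
    by (simp add: fun_eq_iff weak.filter_dominating_def dominating_def eventually_principal)
  then show "network_weight (whitney_topology \<B>) =o
      dominating_number \<B> *c topological_density (whitney_topology \<B>) *c bornology_network_weight \<B>"
    using weak.network_weight_fun_topology
    by (simp add: whitney_topology_def dominating_number_def)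
qed

end
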